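(* For every $P_{\mathrm{th}}\in\mathbb{R}$, the optimization problem $$\text{(I)}\quad \min_{\boldsymbol{\pi},\boldsymbol{F}}\ \frac1\alpha\sum_{q=0}^{Q}\sum_{a=0}^{A}q\,\pi(q,a)$$ over policies $\boldsymbol{F}=\{f_{q,a}^s\}$ and $\boldsymbol{\pi}=\{\pi(q,a)\}$, subject to $\sum_{q,a,s}P(s)\pi(q,a)f_{q,a}^s\le P_{\mathrm{th}}$; $\sum_{q,a}\pi(q,a)\lambda_{(q,a),(q',a')}=\pi(q',a')$ for all $q',a'$ (with $\lambda$ the transition probabilities under $\boldsymbol{F}$); $\sum_{q,a}\pi(q,a)=1$; $\sum_s f_{q,a}^s=1$ for all $q,a$; $\pi(q,a)\ge0$, $f_{q,a}^s\ge0$ for all $q,a,s$; is equivalent to the linear program $$\text{(II)}\quad \min_{\{x_{q,a}^s\}}\ \frac1\alpha\sum_{q=0}^{Q}\sum_{a=0}^{A}\sum_{s=0}^{S}q\,x_{q,a}^s$$ subject to $\sum_{q,a,s}P(s)x_{q,a}^s\le P_{\mathrm{th}}$; $$\sum_{q=\max\{q'-a',0\}}^{\min\{q'-a'+S,Q\}}\sum_{a=0}^{A}\sum_{s=0}^{S}\gamma_{a,a'}x_{q,a}^s\mathbf{1}_{\{s=q+a'-q'\}}=\sum_{s=0}^{S}x_{q',a'}^s\quad\text{for all }0\le q'\le Q,\ 0\le a'\le A;$$ $\sum_{q,a,s}x_{q,a}^s=1$; $x_{q,a}^s\ge0$ for all $0\le q\le Q$, $0\le a\le A$, $0\le s\le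 S$; and $x_{q,a}^s=0$ whenever $s\notin\mathcal{S}(q)$. Here equivalence means: the substitution $x_{q,a}^s=\pi(q,a)f_{q,a}^s$ maps the feasible set of (I) onto the feasible set of (II), and corresponding feasible points have the same objective value (average delay) and the same average power.
   Context: Setting (single queue, adaptive transmitter, AWGN channel). Integers $A\ge1$, $S\ge A$, $Q\ge A$. Arrivals $a[n]\in\{0,\dots,A\}$ form a stationary ergodic (irreducible, aperiodic) Markov chain with transition probabilities $\gamma_{a,a'}$; $\alpha=\sum_a a\phi_a>0$ is the mean number of arrivals per slot, where $\phi$ is its stationary distribution. The queue length $q[n]\in\{0,\dots,Q\}$ evolves by $q[n+1]=q[n]-s[n]+a[n+1]$, where $s[n]\in\{0,\dots,S\}$ is the transmission rate, which must lie in the feasible set $$\mathcal{S}(q)=\{s:\max\{q-Q+A,0\}\le s\le\min\{q,S\}\},\quad q=q[n].$$ $P:\{0,\dots,S\}\to\mathbb{R}$ is the power consumption, with $P(0)=0$, $P$ monotonically increasing and convex. A policy is a family $\boldsymbol{F}=\{f_{q,a}^s:0\le q\le Q,0\le a\le A,0\le s\le S\}$ with $f_{q,a}^s\ge0$, $\sum_s f_{q,a}^s=1$, and $f_{q,a}^s=0$ for $s\notin\mathcal{S}(q)$; $f_{q,a}^s$ is the probability of $s[n]=s$ given $q[n]=q,a[n]=a$. Under $\boldsymbol{F}$, the state $(q[n],a[n])$ is a Markov chain with transition probabilities $$\lambda_{(q,a),(q',a')}=\gamma_{a,a'}f_{q,a}^{q-q'+a'}\mathbf{1}_{\{\max\{q-S,0\}\le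 q'-a'\le\min\{q,Q-A\}\}}.$$ *)

theory Defs
  imports Complex_Main
begin

text \<open>
  Queue lengths, arrivals and rates are natural numbers ranging over \<open>{..Q}\<close>, \<open>{..A}\<close> and \<open>{..S}\<close>.
  Differences of such quantities are taken in \<open>int\<close>, since subtraction on \<open>nat\<close> truncates.
\<close>

definition stochastic_matrix :: "nat \<Rightarrow> (nat \<Rightarrow> nat \<Rightarrow> real) \<Rightarrow> bool" where
  "stochastic_matrix A \<gamma> \<longleftrightarrow>
     (\<forall>a\<le>A. \<forall>a'\<le>A. \<gamma> a a' \<ge> 0) \<and> (\<forall>a\<le>A. (\<Sum>a'\<le>A. \<gamma> a a') = 1)"

primrec n_step :: "nat \<Rightarrow> (nat \<Rightarrow> nat \<Rightarrow> real) \<Rightarrow> nat \<Rightarrow> nat \<Rightarrow> nat \<Rightarrow> real" where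
  "n_step A \<gamma> 0 a a' = of_bool (a = a')"
| "n_step A \<gamma> (Suc n) a a' = (\<Sum>b\<le>A. \<gamma> a b * n_step A \<gamma> n b a')"

definition irreducible_chain :: "nat \<Rightarrow> (nat \<Rightarrow> nat \<Rightarrow> real) \<Rightarrow> bool" where
  "irreducible_chain A \<gamma> \<longleftrightarrow> (\<forall>a\<le>A. \<forall>a'\<le>A. \<exists>n. n_step A \<gamma> n a a' > 0)"

definition aperiodic_chain :: "nat \<Rightarrow> (nat \<Rightarrow> nat \<Rightarrow> real) \<Rightarrow> bool" where
  "aperiodic_chain A \<gamma> \<longleftrightarrow> (\<forall>a\<le>A. Gcd {n. n \<ge> 1 \<and> n_step A \<gamma> n a a > 0} = 1)"

definition stationary_distribution :: "nat \<Rightarrow> (nat \<Rightarrow> nat \<Rightarrow> real) \<Rightarrow> (nat \<Rightarrow> real) \<Rightarrow> bool" where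
  "stationary_distribution A \<gamma> \<phi> \<longleftrightarrow>
     (\<forall>a\<le>A. \<phi> a \<ge> 0) \<and> (\<Sum>a\<le>A. \<phi> a) = 1 \<and> (\<forall>a'\<le>A. (\<Sum>a\<le>A. \<phi> a * \<gamma> a a') = \<phi> a')"

definition mean_arrivals :: "nat \<Rightarrow> (nat \<Rightarrow> real) \<Rightarrow> real" where
  "mean_arrivals A \<phi> = (\<Sum>a\<le>A. real a * \<phi> a)"

text \<open>
  The library's \<open>convex_on\<close> needs a vector space; here the inequality is required at all points of
  the discrete domain.
\<close>

definition convex_upto :: "nat \<Rightarrow> (nat \<Rightarrow> real) \<Rightarrow> bool" where
  "convex_upto S P \<longleftrightarrow>
     (\<forall>u\<le>S. \<forall>v\<le>S. \<forall>w\<le>S. \<forall>t::real. 0 \<le> t \<and> t \<le> 1 \<and> real w = (1 - t) * real u + t * real v \<longrightarrow>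
        P w \<le> (1 - t) * P u + t * P v)"

definition feasible_rates :: "nat \<Rightarrow> nat \<Rightarrow> nat \<Rightarrow> nat \<Rightarrow> nat set" where
  "feasible_rates A S Q q =
     {s. max (int q - int Q + int A) 0 \<le> int s \<and> int s \<le> min (int q) (int S)}"

text \<open>
  A family indexed by a finite range is represented by a function that is \<open>0\<close> outside that range,
  so that equality of functions is equality of families.
\<close>

definition policies :: "nat \<Rightarrow> nat \<Rightarrow> nat \<Rightarrow> (nat \<Rightarrow> nat \<Rightarrow> nat \<Rightarrow> real) set" where
  "policies A S Q = {f.
     (\<forall>q\<le>Q. \<forall>a\<le>A. \<forall>s\<le>S. f q a s \<ge> 0) \<and>
     (\<forall>q\<le>Q. \<forall>a\<le>A. (\<Sum>s\<le>S. f q a s) = 1) \<and>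
     (\<forall>q\<le>Q. \<forall>a\<le>A. \<forall>s\<le>S. s \<notin> feasible_rates A S Q q \<longrightarrow> f q a s = 0) \<and>
     (\<forall>q a s. q > Q \<or> a > A \<or> s > S \<longrightarrow> f q a s = 0)}"

text \<open>The indicator forces \<open>0 \<le> q - q' + a' \<le> S\<close>, so the use of \<open>nat\<close> is harmless.\<close>

definition transition_prob ::
  "nat \<Rightarrow> nat \<Rightarrow> nat \<Rightarrow> (nat \<Rightarrow> nat \<Rightarrow> real) \<Rightarrow> (nat \<Rightarrow> nat \<Rightarrow> nat \<Rightarrow> real) \<Rightarrow> nat \<times> nat \<Rightarrow> nat \<times> nat \<Rightarrow> real"
where
  "transition_prob A S Q \<gamma> f = (\<lambda>(q, a) (q', a').
     \<gamma> a a' * f q a (nat (int q - int q' + int a')) *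
     of_bool (max (int q - int S) 0 \<le> int q' - int a' \<and>
              int q' - int a' \<le> min (int q) (int Q - int A)))"

definition delay_I :: "nat \<Rightarrow> nat \<Rightarrow> (nat \<Rightarrow> real) \<Rightarrow> (nat \<Rightarrow> nat \<Rightarrow> real) \<Rightarrow> real" where
  "delay_I A Q \<phi> \<pi> = 1 / mean_arrivals A \<phi> * (\<Sum>q\<le>Q. \<Sum>a\<le>A. real q * \<pi> q a)"

definition power_I ::
  "nat \<Rightarrow> nat \<Rightarrow> nat \<Rightarrow> (nat \<Rightarrow> real) \<Rightarrow> (nat \<Rightarrow> nat \<Rightarrow> real) \<Rightarrow> (nat \<Rightarrow> nat \<Rightarrow> nat \<Rightarrow> real) \<Rightarrow> real"
where
  "power_I A S Q P \<pi> f = (\<Sum>q\<le>Q. \<Sum>a\<le>A. \<Sum>s\<le>S. P s * \<pi> q a * f q a s)"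

definition feasible_I ::
  "nat \<Rightarrow> nat \<Rightarrow> nat \<Rightarrow> (nat \<Rightarrow> nat \<Rightarrow> real) \<Rightarrow> (nat \<Rightarrow> real) \<Rightarrow> real \<Rightarrow>
   ((nat \<Rightarrow> nat \<Rightarrow> real) \<times> (nat \<Rightarrow> nat \<Rightarrow> nat \<Rightarrow> real)) set"
where
  "feasible_I A S Q \<gamma> P P\<^sub>t\<^sub>h = {(\<pi>, f).
     f \<in> policies A S Q \<and>
     power_I A S Q P \<pi> f \<le> P\<^sub>t\<^sub>h \<and>
     (\<forall>q'\<le>Q. \<forall>a'\<le>A.
        (\<Sum>q\<le>Q. \<Sum>a\<le>A. \<pi> q a * transition_prob A S Q \<gamma> f (q, a) (q', a')) = \<pi> q' a') \<and>
     (\<Sum>q\<le>Q. \<Sum>a\<le>A. \<pi> q a) = 1 \<and>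
     (\<forall>q\<le>Q. \<forall>a\<le>A. \<pi> q a \<ge> 0) \<and>
     (\<forall>q a. q > Q \<or> a > A \<longrightarrow> \<pi> q a = 0)}"

definition delay_II ::
  "nat \<Rightarrow> nat \<Rightarrow> nat \<Rightarrow> (nat \<Rightarrow> real) \<Rightarrow> (nat \<Rightarrow> nat \<Rightarrow> nat \<Rightarrow> real) \<Rightarrow> real"
where
  "delay_II A S Q \<phi> x = 1 / mean_arrivals A \<phi> * (\<Sum>q\<le>Q. \<Sum>a\<le>A. \<Sum>s\<le>S. real q * x q a s)"

definition power_II ::
  "nat \<Rightarrow> nat \<Rightarrow> nat \<Rightarrow> (nat \<Rightarrow> real) \<Rightarrow> (nat \<Rightarrow> nat \<Rightarrow> nat \<Rightarrow> real) \<Rightarrow> real"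
where
  "power_II A S Q P x = (\<Sum>q\<le>Q. \<Sum>a\<le>A. \<Sum>s\<le>S. P s * x q a s)"

definition feasible_II ::
  "nat \<Rightarrow> nat \<Rightarrow> nat \<Rightarrow> (nat \<Rightarrow> nat \<Rightarrow> real) \<Rightarrow> (nat \<Rightarrow> real) \<Rightarrow> real \<Rightarrow>
   (nat \<Rightarrow> nat \<Rightarrow> nat \<Rightarrow> real) set"
where
  "feasible_II A S Q \<gamma> P P\<^sub>t\<^sub>h = {x.
     power_II A S Q P x \<le> P\<^sub>t\<^sub>h \<and>
     (\<forall>q'\<le>Q. \<forall>a'\<le>A.
        (\<Sum>q \<in> {q. max (int q' - int a') 0 \<le> int q \<and> int q \<le> min (int q' - int a' + int S) (int Q)}.
           \<Sum>a\<le>A. \<Sum>s\<le>S. \<gamma> a a' * x q a s * of_bool (int s = int q + int a' - int q'))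
        = (\<Sum>s\<le>S. x q' a' s)) \<and>
     (\<Sum>q\<le>Q. \<Sum>a\<le>A. \<Sum>s\<le>S. x q a s) = 1 \<and>
     (\<forall>q\<le>Q. \<forall>a\<le>A. \<forall>s\<le>S. x q a s \<ge> 0) \<and>
     (\<forall>q\<le>Q. \<forall>a\<le>A. \<forall>s\<le>S. s \<notin> feasible_rates A S Q q \<longrightarrow> x q a s = 0) \<and>
     (\<forall>q a s. q > Q \<or> a > A \<or> s > S \<longrightarrow> x q a s = 0)}"

definition substitution ::
  "(nat \<Rightarrow> nat \<Rightarrow> real) \<times> (nat \<Rightarrow> nat \<Rightarrow> nat \<Rightarrow> real) \<Rightarrow> nat \<Rightarrow> nat \<Rightarrow> nat \<Rightarrow> real" where
  "substitution = (\<lambda>(\<pi>, f) q a s. \<pi> q a * f q a s)"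

end

theory Submission
  imports Defs
begin

text \<open>
  Given a feasible \<open>x\<close> of (II), put \<open>\<pi> q a = (\<Sum>s\<le>S. x q a s)\<close> and \<open>f = x / \<pi>\<close>. Where \<open>\<pi>\<close> vanishes, \<open>f\<close> may be
  any distribution on the feasible rates; the least feasible rate \<open>max (q - Q + A) 0\<close> is chosen
  with probability one. The two balance equations agree term by term: the summation bounds on \<open>q\<close>
  in (II) only discard rates outside \<open>{..S}\<close>, and the indicator in the transition
  probabilities only discards infeasible rates.
\<close>

text \<open>The left-hand side of the balance equation in \<open>feasible_II\<close>, copied
  verbatim so that \<open>feasible_II_altdef\<close> holds by unfolding alone.\<close>

definition occupation_flow ::
  "nat \<Rightarrow> nat \<Rightarrow> nat \<Rightarrow> (nat \<Rightarrow> nat \<Rightarrow> real) \<Rightarrow> (nat \<Rightarrow> nat \<Rightarrow> nat \<Rightarrow> real) \<Rightarrow> nat \<Rightarrow> nat \<Rightarrow> real"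
where
  "occupation_flow A S Q \<gamma> x q' a' =
     (\<Sum>q \<in> {q. max (int q' - int a') 0 \<le> int q \<and> int q \<le> min (int q' - int a' + int S) (int Q)}.
        \<Sum>a\<le>A. \<Sum>s\<le>S. \<gamma> a a' * x q a s * of_bool (int s = int q + int a' - int q'))"

lemma occupation_flow_unrestricted:
  "occupation_flow A S Q \<gamma> x q' a' =
     (\<Sum>q\<le>Q. \<Sum>a\<le>A. \<Sum>s\<le>S. \<gamma> a a' * x q a s * of_bool (int s = int q + int a' - int q'))"
  unfolding occupation_flow_def
proof (rule sum.mono_neutral_left)
  \<comment> \<open>For such \<open>q\<close>, the rate \<open>q + a' - q'\<close> is negative or
    exceeds \<open>S\<close>, so no summation index \<open>s\<close> meets the indicator.\<close>
  show "\<forall>q \<in> {..Q} - {q. max (int q' - int a') 0 \<le> int q \<and>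
                    int q \<le> min (int q' - int a' + int S) (int Q)}.
          (\<Sum>a\<le>A. \<Sum>s\<le>S. \<gamma> a a' * x q a s * of_bool (int s = int q + int a' - int q')) = 0"
    by (auto intro!: sum.neutral)
qed auto

text \<open>Given \<open>a'\<close>, only the rate \<open>q + a' - q'\<close> leads from
  \<open>q\<close> to \<open>q'\<close>, so the sum has at most one nonzero term.\<close>

lemma transition_prob_eq_sum:
  assumes "f \<in> policies A S Q" "q \<le> Q" "a \<le> A"
  shows "transition_prob A S Q \<gamma> f (q, a) (q', a') =
           (\<Sum>s\<le>S. \<gamma> a a' * f q a s * of_bool (int s = int q + int a' - int q'))"
proof (cases "0 \<le> int q + int a' - int q' \<and> int q + int a' - int q' \<le> int S")
  case True
  define s where "s = nat (int q + int a' - int q')"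
  have int_s: "int s = int q + int a' - int q'" and "s \<le> S"
    using True by (auto simp: s_def)
  have "(\<Sum>t\<le>S. \<gamma> a a' * f q a t * of_bool (int t = int q + int a' - int q'))
          = (\<Sum>t\<le>S. if t = s then \<gamma> a a' * f q a s else 0)"
    by (intro sum.cong) (auto simp flip: int_s)
  also have "\<dots> = \<gamma> a a' * f q a s"
    using \<open>s \<le> S\<close> by simp
  also have "\<dots> = transition_prob A S Q \<gamma> f (q, a) (q', a')"
  proof (cases "s \<in> feasible_rates A S Q q")
    case True
    \<comment> \<open>Since \<open>q' - a' = q - s\<close>, the bounds on \<open>s\<close> in
      \<open>feasible_rates\<close> turn into the bounds in the indicator.\<close>
    with int_s have "max (int q - int S) 0 \<le> int q' - int a'"
        "int q' - int a' \<le> min (int q) (int Q - int A)"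
      by (auto simp: feasible_rates_def)
    moreover have "nat (int q - int q' + int a') = s"
      using int_s by simp
    ultimately show ?thesis
      by (simp add: transition_prob_def)
  next
    case False
    then have "f q a s = 0"
      using assms \<open>s \<le> S\<close> by (auto simp: policies_def)
    moreover have "nat (int q - int q' + int a') = s"
      using int_s by simp
    ultimately show ?thesis
      by (simp add: transition_prob_def)
  qed
  finally show ?thesis ..
next
  case False
  \<comment> \<open>Now \<open>q' - a'\<close> is above \<open>q\<close> or below
    \<open>q - S\<close>, so the indicator in \<open>transition_prob\<close> vanishes, as does every
    term of the sum.\<close>
  then show ?thesis
    by (auto simp: transition_prob_def intro!: sum.neutral)
qed

lemma occupation_flow_substitution:
  assumes "f \<in> policies A S Q"
  shows "occupation_flow A S Q \<gamma> (substitution (\<pi>, f)) q' a' =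
           (\<Sum>q\<le>Q. \<Sum>a\<le>A. \<pi> q a * transition_prob A S Q \<gamma> f (q, a) (q', a'))"
  unfolding occupation_flow_unrestricted
  by (intro sum.cong)
    (auto simp: transition_prob_eq_sum[OF assms] substitution_def sum_distrib_left mult_ac
      intro!: sum.cong)

lemma sum_substitution:
  assumes "f \<in> policies A S Q" "q \<le> Q" "a \<le> A"
  shows "(\<Sum>s\<le>S. substitution (\<pi>, f) q a s) = \<pi> q a"
  using assms by (simp add: substitution_def policies_def flip: sum_distrib_left)

lemma power_II_substitution:
  "power_II A S Q P (substitution (\<pi>, f)) = power_I A S Q P \<pi> f"
  by (simp add: power_II_def power_I_def substitution_def mult.assoc)

lemma delay_II_substitution:
  assumes "f \<in> policies A S Q"
  shows "delay_II A S Q \<phi> (substitution (\<pi>, f)) = delay_I A Q \<phi> \<pi>"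
  by (simp add: delay_II_def delay_I_def sum_substitution[OF assms] flip: sum_distrib_left)

lemma feasible_II_altdef:
  "x \<in> feasible_II A S Q \<gamma> P P\<^sub>t\<^sub>h \<longleftrightarrow>
     power_II A S Q P x \<le> P\<^sub>t\<^sub>h \<and>
     (\<forall>q'\<le>Q. \<forall>a'\<le>A. occupation_flow A S Q \<gamma> x q' a' = (\<Sum>s\<le>S. x q' a' s)) \<and>
     (\<Sum>q\<le>Q. \<Sum>a\<le>A. \<Sum>s\<le>S. x q a s) = 1 \<and>
     (\<forall>q\<le>Q. \<forall>a\<le>A. \<forall>s\<le>S. x q a s \<ge> 0) \<and>
     (\<forall>q\<le>Q. \<forall>a\<le>A. \<forall>s\<le>S. s \<notin> feasible_rates A S Q q \<longrightarrow> x q a s = 0) \<and>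
     (\<forall>q a s. q > Q \<or> a > A \<or> s > S \<longrightarrow> x q a s = 0)"
  unfolding feasible_II_def occupation_flow_def by (rule mem_Collect_eq)

lemma substitution_feasible:
  assumes "(\<pi>, f) \<in> feasible_I A S Q \<gamma> P P\<^sub>t\<^sub>h"
  shows "substitution (\<pi>, f) \<in> feasible_II A S Q \<gamma> P P\<^sub>t\<^sub>h"
proof -
  have f: "f \<in> policies A S Q"
    using assms by (simp add: feasible_I_def)
  have "substitution (\<pi>, f) q a s \<ge> 0" if "q \<le> Q" "a \<le> A" "s \<le> S" for q a s
    using that assms f by (simp add: substitution_def feasible_I_def policies_def)
  moreover have "substitution (\<pi>, f) q a s = 0"
    if "q \<le> Q" "a \<le> A" "s \<le> S" "s \<notin> feasible_rates A S Q q" for q a s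
    using that f by (simp add: substitution_def policies_def)
  moreover have "substitution (\<pi>, f) q a s = 0" if "q > Q \<or> a > A \<or> s > S" for q a s
    using that f by (auto simp: substitution_def policies_def)
  ultimately show ?thesis
    \<comment> \<open>As \<open>f\<close> is normalised, summing over the rates gives back \<pi>;
      balance and total mass in (II) thus reduce to those in (I).\<close>
    using assms f
    by (simp add: feasible_II_altdef power_II_substitution occupation_flow_substitution
        sum_substitution feasible_I_def)
qed

text \<open>By \<open>sum_substitution\<close>, the only possible \<pi> in a feasible preimage of
  \<open>x\<close>.\<close>

definition state_marginal :: "nat \<Rightarrow> (nat \<Rightarrow> nat \<Rightarrow> nat \<Rightarrow> real) \<Rightarrow> nat \<Rightarrow> nat \<Rightarrow> real" where
  "state_marginal S x q a = (\<Sum>s\<le>S. x q a s)"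

text \<open>The truncated subtraction \<open>q + A - Q\<close> is the least feasible rate \<open>max (q - Q + A) 0\<close>.\<close>

definition conditional_policy ::
  "nat \<Rightarrow> nat \<Rightarrow> nat \<Rightarrow> (nat \<Rightarrow> nat \<Rightarrow> nat \<Rightarrow> real) \<Rightarrow> nat \<Rightarrow> nat \<Rightarrow> nat \<Rightarrow> real" where
  "conditional_policy A S Q x q a s =
     (if q > Q \<or> a > A then 0
      else if state_marginal S x q a = 0 then of_bool (s = q + A - Q)
      else x q a s / state_marginal S x q a)"

text \<open>For \<open>q \<le> Q\<close> this rate is at most \<open>A \<le> S\<close>, and
  \<open>A \<le> Q\<close> keeps it at most \<open>q\<close>; hence no feasible set is
  empty.\<close>

lemma least_rate_feasible:
  assumes "A \<le> S" "A \<le> Q" "q \<le> Q"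
  shows "q + A - Q \<in> feasible_rates A S Q q"
  using assms by (auto simp: feasible_rates_def)

lemma conditional_policy_in_policies:
  assumes "A \<le> S" "A \<le> Q" "x \<in> feasible_II A S Q \<gamma> P P\<^sub>t\<^sub>h"
  shows "conditional_policy A S Q x \<in> policies A S Q"
proof -
  let ?f = "conditional_policy A S Q x"
  have x_nonneg: "x q a s \<ge> 0" if "q \<le> Q" "a \<le> A" "s \<le> S" for q a s
    using assms(3) that by (simp add: feasible_II_altdef)
  have "?f q a s \<ge> 0" if "q \<le> Q" "a \<le> A" "s \<le> S" for q a s
    using that x_nonneg by (auto simp: conditional_policy_def state_marginal_def
        intro!: sum_nonneg divide_nonneg_nonneg)
  moreover have "(\<Sum>s\<le>S. ?f q a s) = 1" if "q \<le> Q" "a \<le> A" for q a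
  proof (cases "state_marginal S x q a = 0")
    case True
    moreover have "q + A - Q \<le> S"
      using assms(1) that by linarith
    ultimately show ?thesis
      using that by (simp add: conditional_policy_def of_bool_def)
  next
    case False
    then have "(\<Sum>s\<le>S. ?f q a s) = (\<Sum>s\<le>S. x q a s) / state_marginal S x q a"
      using that by (simp add: conditional_policy_def sum_divide_distrib)
    with False show ?thesis
      by (simp add: state_marginal_def)
  qed
  moreover have "?f q a s = 0"
    if "q \<le> Q" "a \<le> A" "s \<le> S" "s \<notin> feasible_rates A S Q q" for q a s
    using assms(3) that least_rate_feasible[OF assms(1,2) that(1)]
    by (auto simp: conditional_policy_def feasible_II_altdef)
  \<comment> \<open>For \<open>s > S\<close> both branches give 0: \<open>x\<close> vanishes there,
    and the default rate is at most \<open>A \<le> S\<close>.\<close>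
  moreover have "?f q a s = 0" if "q > Q \<or> a > A \<or> s > S" for q a s
    using that assms by (auto simp: conditional_policy_def feasible_II_altdef)
  ultimately show ?thesis
    by (simp add: policies_def)
qed

lemma substitution_conditional_policy:
  assumes "x \<in> feasible_II A S Q \<gamma> P P\<^sub>t\<^sub>h"
  shows "substitution (state_marginal S x, conditional_policy A S Q x) = x"
proof (intro ext)
  fix q a s
  have outside: "x q a s = 0" if "q > Q \<or> a > A \<or> s > S"
    using assms that by (auto simp: feasible_II_altdef)
  \<comment> \<open>The product is 0 here whatever the default policy is, so \<open>x\<close> must
    vanish as well: its nonnegative entries sum to 0.\<close>
  have "x q a s = 0" if "q \<le> Q" "a \<le> A" "state_marginal S x q a = 0"
  proof (cases "s \<le> S")
    case True
    have "\<forall>t\<in>{..S}. x q a t = 0"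
      using assms that
      by (subst sum_nonneg_eq_0_iff[symmetric])
        (auto simp: state_marginal_def feasible_II_altdef)
    with True show ?thesis by simp
  qed (use outside in auto)
  with outside show "substitution (state_marginal S x, conditional_policy A S Q x) q a s = x q a s"
    by (auto simp: substitution_def conditional_policy_def)
qed

text \<open>The substitution sends this pair back to \<open>x\<close>, so the identities used for
  the forward direction, read from right to left, turn each constraint of (I) into one that
  \<open>x\<close> satisfies.\<close>

lemma feasible_I_of_feasible_II:
  assumes "A \<le> S" "A \<le> Q" "x \<in> feasible_II A S Q \<gamma> P P\<^sub>t\<^sub>h"
  shows "(state_marginal S x, conditional_policy A S Q x) \<in> feasible_I A S Q \<gamma> P P\<^sub>t\<^sub>h"
proof -
  let ?\<pi> = "state_marginal S x" and ?f = "conditional_policy A S Q x"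
  note f = conditional_policy_in_policies[OF assms]
  note x = substitution_conditional_policy[OF assms(3)]
  have "power_I A S Q P ?\<pi> ?f \<le> P\<^sub>t\<^sub>h"
    using assms(3) by (simp add: x feasible_II_altdef flip: power_II_substitution)
  moreover have "(\<Sum>q\<le>Q. \<Sum>a\<le>A. ?\<pi> q a * transition_prob A S Q \<gamma> ?f (q, a) (q', a')) = ?\<pi> q' a'"
    if "q' \<le> Q" "a' \<le> A" for q' a'
    \<comment> \<open>The marginal is unfolded at \<open>(q', a')\<close> only; under the sum it
      stays folded, so that the substituted pair can be rewritten to \<open>x\<close>.\<close>
    using assms(3) that
    by (simp add: x feasible_II_altdef state_marginal_def[of S x q' a']
        flip: occupation_flow_substitution[OF f])
  moreover have "(\<Sum>q\<le>Q. \<Sum>a\<le>A. ?\<pi> q a) = 1"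
    using assms(3) by (simp add: feasible_II_altdef state_marginal_def)
  moreover have "?\<pi> q a \<ge> 0" if "q \<le> Q" "a \<le> A" for q a
    using assms(3) that by (auto simp: feasible_II_altdef state_marginal_def intro!: sum_nonneg)
  moreover have "?\<pi> q a = 0" if "q > Q \<or> a > A" for q a
    using assms(3) that by (auto simp: feasible_II_altdef state_marginal_def intro!: sum.neutral)
  ultimately show ?thesis
    using f by (simp add: feasible_I_def)
qed

theorem theorem1:
  fixes A S Q :: nat
    and \<gamma> :: "nat \<Rightarrow> nat \<Rightarrow> real"
    and \<phi> :: "nat \<Rightarrow> real"
    and P :: "nat \<Rightarrow> real"
    and P\<^sub>t\<^sub>h :: real
  assumes "A \<ge> 1" and "S \<ge> A" and "Q \<ge> A"
    and "stochastic_matrix A \<gamma>"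
    and "irreducible_chain A \<gamma>"
    and "aperiodic_chain A \<gamma>"
    and "stationary_distribution A \<gamma> \<phi>"
    and "mean_arrivals A \<phi> > 0"
    and "P 0 = 0"
    and "mono_on {..S} P"
    and "convex_upto S P"
  shows "substitution ` feasible_I A S Q \<gamma> P P\<^sub>t\<^sub>h = feasible_II A S Q \<gamma> P P\<^sub>t\<^sub>h \<and>
         (\<forall>(\<pi>, f) \<in> feasible_I A S Q \<gamma> P P\<^sub>t\<^sub>h.
            delay_I A Q \<phi> \<pi> = delay_II A S Q \<phi> (substitution (\<pi>, f)) \<and>
            power_I A S Q P \<pi> f = power_II A S Q P (substitution (\<pi>, f)))"
proof (intro conjI)
  show "substitution ` feasible_I A S Q \<gamma> P P\<^sub>t\<^sub>h = feasible_II A S Q \<gamma> P P\<^sub>t\<^sub>h"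
  proof (intro equalityI subsetI)
    \<comment> \<open>Surjectivity, with the marginal and the conditional policy of \<open>x\<close>
      as preimage.\<close>
    fix x assume "x \<in> feasible_II A S Q \<gamma> P P\<^sub>t\<^sub>h"
    with assms(2,3) show "x \<in> substitution ` feasible_I A S Q \<gamma> P P\<^sub>t\<^sub>h"
      by (metis feasible_I_of_feasible_II substitution_conditional_policy image_eqI)
  qed (auto intro: substitution_feasible)
  show "\<forall>(\<pi>, f) \<in> feasible_I A S Q \<gamma> P P\<^sub>t\<^sub>h.
          delay_I A Q \<phi> \<pi> = delay_II A S Q \<phi> (substitution (\<pi>, f)) \<and>
          power_I A S Q P \<pi> f = power_II A S Q P (substitution (\<pi>, f))"
    by (auto simp: feasible_I_def delay_II_substitution power_II_substitution)
qed

end
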